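(* Let $H$ be a simple graph such that $1$ is a simple eigenvalue of its adjacency matrix $A_H$ and $-1$ is not an eigenvalue of $A_H$. Then the graph $G=K_2\,\square\,H$ satisfies the ACK property: there exists a nonzero $\{0,1\}$-vector in the row space of $A_G$ over $\mathbb{R}$ that is not one of the rows of $A_G$.
   Context: The cartesian product $G_1\square G_2$ has vertex set $V(G_1)\times V(G_2)$, with $(u_1,u_2)$ adjacent to $(v_1,v_2)$ iff either $u_1=v_1$ and $u_2v_2\in E(G_2)$, or $u_2=v_2$ and $u_1v_1\in E(G_1)$. Thus $K_2\square H$ consists of two copies of $H$ with each vertex joined to its copy; its adjacency matrix is $\begin{pmatrix}A_H& I\\ I& A_H\end{pmatrix}$. *)

theory Defs
  imports
    "Graph_Theory.Kuratowski"
    "Jordan_Normal_Form.Char_Poly"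
    "Jordan_Normal_Form.VS_Connect"
begin

text \<open>
  A simple graph is a \<^locale>\<open>pair_graph\<close>: a finite, symmetric, loop-free set of arcs between
  the vertices, so each undirected edge is represented by its two orientations.
\<close>

definition cartesian_product ::
    "'a pair_pre_digraph \<Rightarrow> 'b pair_pre_digraph \<Rightarrow> ('a \<times> 'b) pair_pre_digraph" where
  "cartesian_product G1 G2 =
     \<lparr> pverts = pverts G1 \<times> pverts G2,
       parcs = {((u1, u2), (v1, v2)).
                  u1 \<in> pverts G1 \<and> u2 \<in> pverts G2 \<and> v1 \<in> pverts G1 \<and> v2 \<in> pverts G2 \<and>
                  (u1 = v1 \<and> (u2, v2) \<in> parcs G2 \<or> u2 = v2 \<and> (u1, v1) \<in> parcs G1)} \<rparr>"

lemma pair_graph_cartesian_product: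
  assumes "pair_graph G1" "pair_graph G2"
  shows "pair_graph (cartesian_product G1 G2)"
proof -
  interpret G1: pair_graph G1 by fact
  interpret G2: pair_graph G2 by fact
  let ?P = "cartesian_product G1 G2"
  have fin: "finite (pverts ?P)"
    by (simp add: cartesian_product_def G1.pair_finite_verts G2.pair_finite_verts)
  have sub: "parcs ?P \<subseteq> pverts ?P \<times> pverts ?P"
    by (auto simp: cartesian_product_def)
  have "sym (parcs ?P)"
    using G1.sym_arcs G2.sym_arcs by (auto simp: cartesian_product_def sym_def symmetric_def)
  moreover have "fst e \<noteq> snd e" if "e \<in> parcs ?P" for e
    using that G1.pair_no_loops G2.pair_no_loops by (fastforce simp: cartesian_product_def)
  ultimately show ?thesis
    using fin sub finite_subset[OF sub] by unfold_locales (auto simp: symmetric_def)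
qed

text \<open>
  Matrices are indexed by natural numbers, so an adjacency matrix is taken with respect to an
  enumeration of the vertices. A different enumeration permutes rows and columns simultaneously.
\<close>

definition vertex_enum :: "'a pair_pre_digraph \<Rightarrow> 'a list \<Rightarrow> bool" where
  "vertex_enum G vs \<longleftrightarrow> distinct vs \<and> set vs = pverts G"

definition adjacency_matrix :: "'a pair_pre_digraph \<Rightarrow> 'a list \<Rightarrow> real mat" where
  "adjacency_matrix G vs = mat (length vs) (length vs)
     (\<lambda>(i, j). if (vs ! i, vs ! j) \<in> parcs G then 1 else 0)"

text \<open>Simplicity refers to the algebraic multiplicity.\<close>

definition simple_eigenvalue :: "'a :: field mat \<Rightarrow> 'a \<Rightarrow> bool" where
  "simple_eigenvalue A k \<longleftrightarrow> eigenvalue A k \<and> Polynomial.order k (char_poly A) = 1"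

definition ACK_property :: "'a pair_pre_digraph \<Rightarrow> bool" where
  "ACK_property G \<longleftrightarrow> finite (pverts G) \<and>
     (\<forall>vs. vertex_enum G vs \<longrightarrow>
       (let n = length vs; A = adjacency_matrix G vs in
         \<exists>x \<in> vec_space.row_space n A.
           x \<noteq> 0\<^sub>v n \<and> (\<forall>i<n. x $ i \<in> {0, 1}) \<and> x \<notin> set (rows A)))"

end

theory Submission
  imports Defs
begin

text \<open>
  Write $e_h$ for the indicator vector of a vertex $h$ of $H$. Since $-1$ is not an eigenvalue,
  $A_H + I$ is invertible, so $(A_H + I) y = e_h$ has a solution, and then
  $A_G (y, y) = (e_h, e_h)$, which is therefore in the row space of the symmetric matrix $A_G$.
  It is not a row: the row of $(k, u)$ has an entry $1$ at the other copy of $u$, which forces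
  $u = h$, but then its entry at $(k, h)$ would have to be $1$ as well, and it lies on the diagonal.
\<close>

lemma mult_mat_vec_surj:
  fixes A :: "'a :: field mat"
  assumes A: "A \<in> carrier_mat n n" and "det A \<noteq> 0" and b: "b \<in> carrier_vec n"
  obtains x where "x \<in> carrier_vec n" "A *\<^sub>v x = b"
proof -
  obtain B where B: "B \<in> carrier_mat n n" "A * B = 1\<^sub>m n"
    \<comment> \<open>The \<open>()\<close> fills the record extension slot of
      \<open>ring_mat\<close>, whose units are the invertible matrices.\<close>
    using det_non_zero_imp_unit[OF assms(1,2), of "()"]
    by (auto simp: Units_def ring_mat_def)
  have "A *\<^sub>v (B *\<^sub>v b) = b"
    using assoc_mult_mat_vec[OF A B(1) b] B(2) b by simp
  then show ?thesis
    using that[of "B *\<^sub>v b"] B b by auto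
qed

lemma adjacency_matrix_carrier [simp]:
  "adjacency_matrix G vs \<in> carrier_mat (length vs) (length vs)"
  by (simp add: adjacency_matrix_def)

text \<open>This trades indices for vertices: with vectors given as functions on vertices, the
  matrix becomes the operator summing over neighbours, and the chosen enumeration disappears from
  the computations.\<close>

lemma adjacency_matrix_mult_vec:
  assumes "vertex_enum G vs" "i < length vs"
  shows "(adjacency_matrix G vs *\<^sub>v vec (length vs) (\<lambda>j. f (vs ! j))) $ i =
    (\<Sum>w\<in>pverts G. if (vs ! i, w) \<in> parcs G then f w else 0)"
proof -
  have bij: "bij_betw (\<lambda>j. vs ! j) {0..<length vs} (pverts G)"
    using assms(1) bij_betw_nth[of vs "{0..<length vs}" "pverts G"]
    by (auto simp: vertex_enum_def atLeast0LessThan)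
  have "(adjacency_matrix G vs *\<^sub>v vec (length vs) (\<lambda>j. f (vs ! j))) $ i =
      (\<Sum>j = 0..<length vs. if (vs ! i, vs ! j) \<in> parcs G then f (vs ! j) else 0)"
    using assms(2) by (auto simp: adjacency_matrix_def scalar_prod_def intro!: sum.cong)
  also have "\<dots> = (\<Sum>w\<in>pverts G. if (vs ! i, w) \<in> parcs G then f w else 0)"
    by (rule sum.reindex_bij_betw[OF bij])
  finally show ?thesis .
qed

lemma transpose_adjacency_matrix:
  assumes "pair_graph G"
  shows "(adjacency_matrix G vs)\<^sup>T = adjacency_matrix G vs"
proof -
  interpret pair_graph G by fact
  have "(v, u) \<in> parcs G" if "(u, v) \<in> parcs G" for u v
    using that sym_arcs by (auto simp: symmetric_def sym_def)
  then show ?thesis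
    by (auto simp: adjacency_matrix_def)
qed

text \<open>The row space is the image of the transpose. Adjacency is symmetric, so it is also the
  image of the matrix itself, and solving A y = f on vertices is enough.\<close>

lemma adjacency_matrix_row_space:
  assumes "pair_graph G" "vertex_enum G vs"
    and "\<And>u. u \<in> pverts G \<Longrightarrow> (\<Sum>w\<in>pverts G. if (u, w) \<in> parcs G then y w else 0) = f u"
  shows "vec (length vs) (\<lambda>i. f (vs ! i)) \<in>
    vec_space.row_space (length vs) (adjacency_matrix G vs)"
proof -
  let ?A = "adjacency_matrix G vs"
  have dim: "dim_row ?A = length vs" "dim_col ?A = length vs"
    by (simp_all add: adjacency_matrix_def)
  have "?A *\<^sub>v vec (length vs) (\<lambda>i. y (vs ! i)) = vec (length vs) (\<lambda>i. f (vs ! i))"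
  proof (rule eq_vecI)
    fix i assume "i < dim_vec (vec (length vs) (\<lambda>i. f (vs ! i)))"
    then have i: "i < length vs"
      by simp
    then have "vs ! i \<in> pverts G"
      using assms(2) nth_mem[of i vs] by (simp add: vertex_enum_def)
    then show "(?A *\<^sub>v vec (length vs) (\<lambda>i. y (vs ! i))) $ i = vec (length vs) (\<lambda>i. f (vs ! i)) $ i"
      using i assms(3) by (simp add: adjacency_matrix_mult_vec[OF assms(2) i])
  qed (simp add: dim)
  then show ?thesis
    unfolding vec_space.row_space_eq[OF adjacency_matrix_carrier] dim
      transpose_adjacency_matrix[OF assms(1)]
    by (auto intro!: bexI[of _ "vec (length vs) (\<lambda>i. y (vs ! i))"])
qed

text \<open>As -1 is not an eigenvalue, A + I has nonzero determinant and hence is surjective. The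
  solution is returned as a function on vertices so that it can be placed on both copies of
  \<open>H\<close>.\<close>

lemma shifted_adjacency_solvable:
  fixes f :: "'a \<Rightarrow> real"
  assumes "vertex_enum H hs" "\<not> eigenvalue (adjacency_matrix H hs) (-1)"
  obtains y where "\<And>u. u \<in> pverts H \<Longrightarrow>
    (\<Sum>w\<in>pverts H. if (u, w) \<in> parcs H then y w else 0) + y u = f u"
proof -
  let ?A = "adjacency_matrix H hs" and ?n = "length hs"
  have dim: "dim_row ?A = ?n"
    by (simp add: adjacency_matrix_def)
  have "det (char_matrix ?A (-1)) \<noteq> 0"
    using assms(2) eigenvalue_det[OF adjacency_matrix_carrier] by blast
  then obtain x where x: "x \<in> carrier_vec ?n"
    "char_matrix ?A (-1) *\<^sub>v x = vec ?n (\<lambda>i. f (hs ! i))"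
    by (rule mult_mat_vec_surj[OF char_matrix_closed[OF adjacency_matrix_carrier]]) auto
  \<comment> \<open>\<open>char_matrix A e\<close> is A - e I, so e = -1 produces the plus
    sign.\<close>
  have "char_matrix ?A (-1) = ?A + 1\<^sub>m ?n"
    by (intro eq_matI) (auto simp: char_matrix_def dim)
  then have Ax: "?A *\<^sub>v x + x = vec ?n (\<lambda>i. f (hs ! i))"
    using x add_mult_distrib_mat_vec[OF adjacency_matrix_carrier, of "1\<^sub>m ?n" hs x H]
    by simp
  \<comment> \<open>The index is unique because \<open>hs\<close> is distinct. Off
    \<open>pverts H\<close> the value is unspecified, but only values at vertices enter the
    sums.\<close>
  define y where "y u = x $ (THE i. i < ?n \<and> hs ! i = u)" for u
  have y_nth: "y (hs ! i) = x $ i" if "i < ?n" for i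
  proof -
    have "(THE j. j < ?n \<and> hs ! j = hs ! i) = i"
      using assms(1) that by (intro the_equality) (auto simp: vertex_enum_def nth_eq_iff_index_eq)
    then show ?thesis
      by (simp add: y_def)
  qed
  have xy: "x = vec ?n (\<lambda>i. y (hs ! i))"
    using x(1) by (intro eq_vecI) (auto simp: y_nth)
  show ?thesis
  proof (rule that[of y])
    fix u assume "u \<in> pverts H"
    then obtain i where i: "i < ?n" "u = hs ! i"
      using assms(1) by (metis vertex_enum_def in_set_conv_nth)
    have "(?A *\<^sub>v x) $ i + x $ i = f u"
      using arg_cong[OF Ax, of "\<lambda>v. v $ i"] i x(1) by simp
    moreover have "(?A *\<^sub>v x) $ i = (\<Sum>w\<in>pverts H. if (u, w) \<in> parcs H then y w else 0)"
      using adjacency_matrix_mult_vec[OF assms(1) i(1), of y] i(2) by (simp flip: xy)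
    ultimately show "(\<Sum>w\<in>pverts H. if (u, w) \<in> parcs H then y w else 0) + y u = f u"
      using y_nth[OF i(1)] i(2) by simp
  qed
qed

text \<open>The neighbours of (k, u) are the (k, w) with w adjacent to u, together with the twin of
  u in the other copy. On a function that ignores the first coordinate, A_G therefore acts as A_H +
  I in each copy.\<close>

lemma cartesian_product_K2_sum:
  fixes y :: "'a \<Rightarrow> real"
  assumes "pair_graph H" "complete_digraph 2 (with_proj K)" "k \<in> pverts K" "u \<in> pverts H"
  shows "(\<Sum>p\<in>pverts (cartesian_product K H).
      if ((k, u), p) \<in> parcs (cartesian_product K H) then y (snd p) else 0) =
    (\<Sum>w\<in>pverts H. if (u, w) \<in> parcs H then y w else 0) + y u"
proof -
  interpret pair_graph H by fact
  have K: "card (pverts K) = 2" "parcs K = {(a, b). (a, b) \<in> pverts K \<times> pverts K \<and> a \<noteq> b}"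
    using assms(2) by (auto simp: complete_digraph_pair_def)
  have verts: "pverts (cartesian_product K H) = pverts K \<times> pverts H"
    by (simp add: cartesian_product_def)
  obtain k' where k': "k \<noteq> k'" "pverts K = {k, k'}"
    using K(1) assms(3) unfolding card_2_iff by (metis insert_commute insertE singletonD)
  have arc: "((k, u), (a, w)) \<in> parcs (cartesian_product K H) \<longleftrightarrow>
      (if a = k then (u, w) \<in> parcs H else w = u)" if "a \<in> pverts K" "w \<in> pverts H" for a w
    using that assms(3,4) k' K(2) pair_no_loops
    by (auto simp: cartesian_product_def)
  have "(\<Sum>p\<in>pverts (cartesian_product K H).
        if ((k, u), p) \<in> parcs (cartesian_product K H) then y (snd p) else 0) =
      (\<Sum>a\<in>pverts K. \<Sum>w\<in>pverts H.
        if ((k, u), (a, w)) \<in> parcs (cartesian_product K H) then y w else 0)"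
    by (simp add: verts sum.cartesian_product case_prod_beta)
  also have "\<dots> = (\<Sum>a\<in>pverts K. \<Sum>w\<in>pverts H.
        if (if a = k then (u, w) \<in> parcs H else w = u) then y w else 0)"
    by (intro sum.cong refl) (simp add: arc)
  also have "\<dots> = (\<Sum>w\<in>pverts H. if (u, w) \<in> parcs H then y w else 0) + y u"
    using k' assms(4) pair_finite_verts by simp
  finally show ?thesis .
qed

theorem theorem5p1:
  fixes H :: "'a pair_pre_digraph" and K :: "'b pair_pre_digraph" and hs :: "'a list"
  assumes "pair_graph H" and "vertex_enum H hs"
    and "simple_eigenvalue (adjacency_matrix H hs) 1"
    and "\<not> eigenvalue (adjacency_matrix H hs) (-1)"
    and "complete_digraph 2 (with_proj K)"
  shows "ACK_property (cartesian_product K H)"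
proof -
  let ?G = "cartesian_product K H"
  interpret H: pair_graph H by fact
  have K: "card (pverts K) = 2" "parcs K = {(a, b). (a, b) \<in> pverts K \<times> pverts K \<and> a \<noteq> b}"
    using assms(5) by (auto simp: complete_digraph_pair_def)
  obtain k k' where k: "k \<noteq> k'" "pverts K = {k, k'}"
    using K(1) by (auto simp: card_2_iff)
  have G: "pair_graph ?G"
    using assms(1,5) by (simp add: pair_graph_cartesian_product pair_graphI_complete)
  then interpret G: pair_graph ?G .
  \<comment> \<open>Having the eigenvalue 1 forces positive dimension, which supplies the vertex
    h.\<close>
  have "length hs \<noteq> 0"
    using assms(3) eigenvalue_imp_nonzero_dim[OF adjacency_matrix_carrier]
    by (auto simp: simple_eigenvalue_def)
  then obtain h where h: "h \<in> pverts H"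
    using assms(2) by (cases hs) (auto simp: vertex_enum_def)
  define f :: "'a \<Rightarrow> real" where "f u = (if u = h then 1 else 0)" for u
  obtain y where y: "\<And>u. u \<in> pverts H \<Longrightarrow>
    (\<Sum>w\<in>pverts H. if (u, w) \<in> parcs H then y w else 0) + y u = f u"
    using shifted_adjacency_solvable[OF assms(2,4), of f] by blast
  have "\<exists>x\<in>vec_space.row_space (length vs) (adjacency_matrix ?G vs).
      x \<noteq> 0\<^sub>v (length vs) \<and> (\<forall>i<length vs. x $ i \<in> {0, 1}) \<and>
      x \<notin> set (rows (adjacency_matrix ?G vs))"
    if vs: "vertex_enum ?G vs" for vs
  proof -
    let ?n = "length vs"
    \<comment> \<open>Composing \<open>f\<close> with \<open>snd\<close> gives (e_h, e_h) for any
      enumeration of the product, however it interleaves the two copies.\<close>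
    let ?x = "vec ?n (\<lambda>i. f (snd (vs ! i)))"
    have idx: "\<exists>i<?n. vs ! i = p" if "p \<in> pverts ?G" for p
      using that vs by (metis vertex_enum_def in_set_conv_nth)
    have "?x \<in> vec_space.row_space ?n (adjacency_matrix ?G vs)"
    proof (rule adjacency_matrix_row_space[OF G vs, where y = "\<lambda>p. y (snd p)"])
      fix p assume p: "p \<in> pverts ?G"
      obtain a u where au: "p = (a, u)"
        by fastforce
      then have "a \<in> pverts K" "u \<in> pverts H"
        using p by (simp_all add: cartesian_product_def)
      then show "(\<Sum>w\<in>pverts ?G. if (p, w) \<in> parcs ?G then y (snd w) else 0) = f (snd p)"
        using cartesian_product_K2_sum[OF assms(1,5), of a u y] y[of u] au by simp
    qed
    moreover have "?x \<noteq> 0\<^sub>v ?n"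
    proof -
      obtain i where "i < ?n" "vs ! i = (k, h)"
        using idx[of "(k, h)"] k h by (auto simp: cartesian_product_def)
      then have "?x $ i \<noteq> 0\<^sub>v ?n $ i"
        by (simp add: f_def)
      then show ?thesis
        by metis
    qed
    moreover have "\<forall>i<?n. ?x $ i \<in> {0, 1}"
      by (simp add: f_def)
    moreover have "?x \<notin> set (rows (adjacency_matrix ?G vs))"
    proof
      assume "?x \<in> set (rows (adjacency_matrix ?G vs))"
      then obtain r where r: "r < ?n" "?x = row (adjacency_matrix ?G vs) r"
        by (auto simp: rows_def adjacency_matrix_def)
      have entry: "f (snd (vs ! j)) = (if (vs ! r, vs ! j) \<in> parcs ?G then 1 else 0)"
        if "j < ?n" for j
        using arg_cong[OF r(2), of "\<lambda>v. v $ j"] that r(1) by (simp add: adjacency_matrix_def)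
      obtain a u where au: "vs ! r = (a, u)"
        by fastforce
      have "(a, u) \<in> pverts ?G"
        using vs r(1) au nth_mem[of r vs] by (simp add: vertex_enum_def)
      then have a: "a \<in> pverts K" "u \<in> pverts H"
        by (simp_all add: cartesian_product_def)
      obtain b where b: "b \<in> pverts K" "b \<noteq> a"
        using k by auto
      obtain j where j: "j < ?n" "vs ! j = (b, u)"
        using idx[of "(b, u)"] a b by (auto simp: cartesian_product_def)
      \<comment> \<open>At the twin (b, u) the row has entry 1 while \<open>?x\<close> has entry
        \<open>f u\<close>, so \<open>f u\<close> = 1.\<close>
      have "((a, u), (b, u)) \<in> parcs ?G"
        using a b K(2) by (auto simp: cartesian_product_def)
      then have "u = h"
        using entry[OF j(1)] j(2) au by (simp add: f_def split: if_splits)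
      \<comment> \<open>Now compare at the row's own index r: \<open>?x\<close> has
        \<open>f h\<close> = 1 there, against the zero diagonal of a loop-free graph.\<close>
      moreover have "((a, u), (a, u)) \<notin> parcs ?G"
        using G.pair_no_loops by fastforce
      ultimately show False
        using entry[OF r(1)] au by (simp add: f_def)
    qed
    ultimately show ?thesis
      by blast
  qed
  then show ?thesis
    by (auto simp: ACK_property_def Let_def G.pair_finite_verts)
qed

end
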